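(* There is an absolute constant $C$ such that the following holds. Let $G$ be an $m_\ell \times m_s$ grid graph with $m_\ell \ge m_s$, $m_\ell \ge 3$, $m_s \ge 2$, and let $X_I, X_G$ be arbitrary configurations of $m_\ell m_s$ labeled robots on $G$ (all vertices occupied). Then the instance $(G, X_I, X_G)$ admits a solution with makespan at most $C\, m_\ell$.
   Context: The $m_\ell \times m_s$ grid graph has vertex set $\{1,\dots,m_\ell\}\times\{1,\dots,m_s\}$ with edges between vertices at $\ell_1$-distance 1 (unit edge lengths). Multi-robot path planning (MPP) on a graph $G=(V,E)$: at each integer time step each robot occupies a vertex and a configuration is an injective map from robot labels to $V$ (here all vertices are occupied, so it is a bijection). From step $t$ to $t+1$ each robot either stays put or moves to an adjacent vertex, subject to: (i) the configuration at $t+1$ is again injective, and (ii) no two robots traverse the same edge in opposite directions. A solution of $(G,X_I,X_G)$ is a sequence of such moves from $X_I$ to $X_G$; its makespan is the number of time steps. *)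

theory Defs
  imports Main
begin

definition grid_vertices :: "nat \<Rightarrow> nat \<Rightarrow> (nat \<times> nat) set" where
  "grid_vertices ml ms = {1..ml} \<times> {1..ms}"

definition grid_adj :: "nat \<Rightarrow> nat \<Rightarrow> nat \<times> nat \<Rightarrow> nat \<times> nat \<Rightarrow> bool" where
  "grid_adj ml ms u v \<longleftrightarrow> u \<in> grid_vertices ml ms \<and> v \<in> grid_vertices ml ms \<and>
     (if fst u \<le> fst v then fst v - fst u else fst u - fst v) +
     (if snd u \<le> snd v then snd v - snd u else snd u - snd v) = 1"

definition robots :: "nat \<Rightarrow> nat \<Rightarrow> nat set" where
  "robots ml ms = {0..<ml * ms}"

definition is_config :: "nat \<Rightarrow> nat \<Rightarrow> (nat \<Rightarrow> nat \<times> nat) \<Rightarrow> bool" where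
  "is_config ml ms X \<longleftrightarrow> bij_betw X (robots ml ms) (grid_vertices ml ms)"

definition valid_step :: "nat \<Rightarrow> nat \<Rightarrow> (nat \<Rightarrow> nat \<times> nat) \<Rightarrow> (nat \<Rightarrow> nat \<times> nat) \<Rightarrow> bool" where
  "valid_step ml ms X Y \<longleftrightarrow> is_config ml ms X \<and> is_config ml ms Y \<and>
     (\<forall>r\<in>robots ml ms. Y r = X r \<or> grid_adj ml ms (X r) (Y r)) \<and>
     (\<forall>r\<in>robots ml ms. \<forall>r'\<in>robots ml ms. r \<noteq> r' \<longrightarrow>
        \<not> (Y r = X r' \<and> Y r' = X r))"

definition mpp_solution :: "nat \<Rightarrow> nat \<Rightarrow> (nat \<Rightarrow> nat \<Rightarrow> nat \<times> nat) \<Rightarrow> nat \<Rightarrow>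
    (nat \<Rightarrow> nat \<times> nat) \<Rightarrow> (nat \<Rightarrow> nat \<times> nat) \<Rightarrow> bool" where
  "mpp_solution ml ms P T XI XG \<longleftrightarrow>
     (\<forall>r\<in>robots ml ms. P 0 r = XI r \<and> P T r = XG r) \<and>
     (\<forall>t<T. valid_step ml ms (P t) (P (Suc t)))"

end

theory Submission
  imports Defs "HOL-Combinatorics.Permutations"
begin

text \<open>Exchanging two adjacent robots costs five steps inside a \<open>3 \<times> 2\<close> block, and the edges of the grid
  fall into boundedly many classes within which these blocks are disjoint. Hence any round of
  disjoint adjacent swaps takes constant time. A permutation of a path on \<open>n\<close> vertices is a
  product of \<open>3 * n\<close> such rounds, and all parallel lines of the grid can be routed simultaneously.
  Finally, every permutation of the grid is a product of one that preserves the first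
  coordinate, one that preserves the second and one that preserves the first: this is the
  edge colouring theorem for regular bipartite multigraphs.\<close>

section \<open>Hall's theorem and edge colourings of regular bipartite multigraphs\<close>

text \<open>With every vertex occupied no robot can move alone: a time step is a permutation of the
  vertices, and rule (ii) excludes its 2-cycles, so exchanging two neighbours directly is illegal. A
  single square yields only its own rotations, never a transposition; two squares sharing an edge do
  yield one, and \<open>ml \<ge> 3\<close>, \<open>ms \<ge> 2\<close> make room for such a pair.
  Three phases are used because robots with the same second coordinate may have the same target
  first coordinate and would collide if sent there at once. The initial phase spreads them out, and
  a proper edge colouring says how. The constant: 5 steps for each of 3 * 2 * 5 * 3 = 90 edge
  classes give 450 steps per round of swaps. With 3 rounds per vertex of a line this is 1350 times
  the length of the line. The lines routed have lengths \<open>ms\<close>, \<open>ml\<close>,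
  \<open>ms\<close>, and \<open>ms \<le> ml\<close> gives 3 * 1350 = 4050.\<close>

lemma hall_marriage:
  assumes "finite I" and "\<And>i. i \<in> I \<Longrightarrow> finite (N i)"
    and "\<And>J. J \<subseteq> I \<Longrightarrow> card J \<le> card (\<Union>(N ` J))"
  shows "\<exists>f. inj_on f I \<and> (\<forall>i\<in>I. f i \<in> N i)"
  using assms
proof (induction I arbitrary: N rule: finite_psubset_induct)
  case (psubset I)
  note fin = psubset.prems(1) and hall = psubset.prems(2)
  have finU: "finite (\<Union>(N ` J))" if "J \<subseteq> I" for J
    using that fin psubset.hyps by (meson finite_UN finite_subset subsetD)
  \<comment> \<open>Either every nonempty proper subfamily has a spare neighbour, so that giving any
    \<open>x\<close> to some \<open>i\<close> keeps Hall's condition for the rest, or some proper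
    subfamily is tight and is matched separately from its complement.\<close>
  consider "I = {}"
    | i where "i \<in> I" "\<And>J. J \<noteq> {} \<Longrightarrow> J \<subset> I \<Longrightarrow> card J < card (\<Union>(N ` J))"
    | J where "J \<noteq> {}" "J \<subset> I" "card (\<Union>(N ` J)) \<le> card J"
    by (meson all_not_in_conv not_le)
  then show ?case
  proof cases
    case 1
    then show ?thesis by simp
  next
    case 2
    have "card {i} \<le> card (N i)"
      using hall[of "{i}"] \<open>i \<in> I\<close> by simp
    then obtain x where x: "x \<in> N i"
      by (metis card.empty card_1_singleton_iff ex_in_conv not_one_le_zero One_nat_def)
    have cond: "card J \<le> card (\<Union>((\<lambda>j. N j - {x}) ` J))" if J: "J \<subseteq> I - {i}" for J
    proof (cases "J = {}")
      case False
      have "J \<subset> I"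
        using J \<open>i \<in> I\<close> by blast
      have "card J < card (\<Union>(N ` J))"
        using 2(2)[OF False \<open>J \<subset> I\<close>] .
      moreover have "\<Union>((\<lambda>j. N j - {x}) ` J) = \<Union>(N ` J) - {x}"
        by blast
      ultimately show ?thesis
        by (auto simp: card_Diff_singleton_if)
    qed simp
    have "I - {i} \<subset> I"
      using \<open>i \<in> I\<close> by blast
    then have "\<exists>f. inj_on f (I - {i}) \<and> (\<forall>j\<in>I - {i}. f j \<in> N j - {x})"
      using psubset.IH[of "I - {i}" "\<lambda>j. N j - {x}"] fin cond by blast
    then obtain f where f: "inj_on f (I - {i})" "\<forall>j\<in>I - {i}. f j \<in> N j - {x}"
      by blast
    have "inj_on (f(i := x)) I"
      using f by (auto simp: inj_on_def)
    moreover have "\<forall>j\<in>I. (f(i := x)) j \<in> N j"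
      using f(2) x by simp
    ultimately show ?thesis
      by blast
  next
    case 3
    let ?U = "\<Union>(N ` J)"
    have "\<exists>f. inj_on f J \<and> (\<forall>j\<in>J. f j \<in> N j)"
    proof (rule psubset.IH)
      show "J \<subset> I" by (rule 3)
      show "finite (N j)" if "j \<in> J" for j
        using that 3 fin by blast
      show "card K \<le> card (\<Union>(N ` K))" if "K \<subseteq> J" for K
        using that 3 by (intro hall) blast
    qed
    then obtain f where f: "inj_on f J" "\<forall>j\<in>J. f j \<in> N j"
      by blast
    \<comment> \<open>Hall's condition for \<open>J \<union> L\<close>, minus the tight contribution
      of \<open>J\<close>, is the condition for \<open>L\<close> outside \<open>?U\<close>.\<close>
    have cond: "card L \<le> card (\<Union>((\<lambda>j. N j - ?U) ` L))" if L: "L \<subseteq> I - J" for L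
    proof -
      have "finite J" "finite L"
        using psubset.hyps 3 L by (meson finite_subset psubset_imp_subset finite_Diff)+
      then have "card J + card L = card (J \<union> L)"
        using L by (subst card_Un_disjoint) auto
      also have "\<dots> \<le> card (\<Union>(N ` (J \<union> L)))"
        using hall[of "J \<union> L"] L 3 by blast
      also have "\<Union>(N ` (J \<union> L)) = ?U \<union> \<Union>((\<lambda>j. N j - ?U) ` L)"
        by blast
      also have "card \<dots> \<le> card ?U + card (\<Union>((\<lambda>j. N j - ?U) ` L))"
        by (rule card_Un_le)
      finally show ?thesis
        using 3 by linarith
    qed
    have "I - J \<subset> I"
      using 3 by blast
    then have "\<exists>g. inj_on g (I - J) \<and> (\<forall>j\<in>I - J. g j \<in> N j - ?U)"
      using psubset.IH[of "I - J" "\<lambda>j. N j - ?U"] fin cond by blast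
    then obtain g where g: "inj_on g (I - J)" "\<forall>j\<in>I - J. g j \<in> N j - ?U"
      by blast
    define h where "h = (\<lambda>i. if i \<in> J then f i else g i)"
    have "inj_on h I"
      using f g unfolding inj_on_def h_def by (smt (verit) Diff_iff UN_I)
    moreover have "\<forall>i\<in>I. h i \<in> N i"
      using f g by (auto simp: h_def)
    ultimately show ?thesis
      by blast
  qed
qed

lemma card_vimage_const_fibers:
  assumes "finite X" "finite J" "\<And>a. a \<in> J \<Longrightarrow> card {x \<in> X. g x = a} = d"
  shows "card {x \<in> X. g x \<in> J} = card J * d"
proof -
  have "{x \<in> X. g x \<in> J} = (\<Union>a\<in>J. {x \<in> X. g x = a})"
    by blast
  also have "card \<dots> = (\<Sum>a\<in>J. card {x \<in> X. g x = a})"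
    using assms by (intro card_UN_disjoint) auto
  finally show ?thesis
    using assms by simp
qed

text \<open>Double counting gives Hall's condition: the \<open>card J * Suc d\<close> edges leaving
  \<open>J\<close> all end in its neighbourhood, each vertex of which receives only
  \<open>Suc d\<close>. The elements of \<open>X\<close> are the edges, so parallel edges stay
  distinct; this is why the matching is returned as a choice \<open>m\<close> of edges and not only
  as \<open>f\<close>.\<close>

lemma regular_bipartite_perfect_matching:
  fixes src dst :: "'x \<Rightarrow> 'a"
  assumes "finite X" "finite A" "dst ` X \<subseteq> A"
    and src: "\<And>a. a \<in> A \<Longrightarrow> card {x \<in> X. src x = a} = Suc d"
    and dst: "\<And>a. a \<in> A \<Longrightarrow> card {x \<in> X. dst x = a} = Suc d"
  obtains m f where "bij_betw f A A"
    "\<forall>a\<in>A. m a \<in> X \<and> src (m a) = a \<and> dst (m a) = f a"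
proof -
  define N where "N a = dst ` {x \<in> X. src x = a}" for a
  have "card J \<le> card (\<Union>(N ` J))" if "J \<subseteq> A" for J
  proof -
    have sub: "\<Union>(N ` J) \<subseteq> A"
      using assms(3) by (auto simp: N_def)
    have fin: "finite J" "finite (\<Union>(N ` J))"
      using sub that assms(2) finite_subset by blast+
    have "card J * Suc d = card {x \<in> X. src x \<in> J}"
      using assms(1) src that fin(1) by (intro card_vimage_const_fibers[symmetric]) auto
    also have "\<dots> \<le> card {x \<in> X. dst x \<in> \<Union>(N ` J)}"
      using assms(1) by (intro card_mono) (auto simp: N_def)
    also have "\<dots> = card (\<Union>(N ` J)) * Suc d"
      using assms(1) dst sub fin by (intro card_vimage_const_fibers) auto
    finally show ?thesis
      by (simp only: mult_le_cancel2)
  qed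
  moreover have "finite (N a)" for a
    using assms(1) by (simp add: N_def)
  ultimately have "\<exists>f. inj_on f A \<and> (\<forall>a\<in>A. f a \<in> N a)"
    using assms(2) by (intro hall_marriage)
  then obtain f where f: "inj_on f A" "\<forall>a\<in>A. f a \<in> N a"
    by blast
  then have "\<forall>a\<in>A. \<exists>x. x \<in> X \<and> src x = a \<and> dst x = f a"
    by (force simp: N_def)
  then obtain m where m: "\<forall>a\<in>A. m a \<in> X \<and> src (m a) = a \<and> dst (m a) = f a"
    by metis
  have "f ` A \<subseteq> A"
    using m assms(3) by (metis image_subset_iff)
  then have "bij_betw f A A"
    using f(1) assms(2) by (simp add: bij_betw_def endo_inj_surj)
  then show ?thesis
    using that m by blast
qed

text \<open>A perfect matching serves as one colour class, and its removal lowers every degree by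
  one. The two injectivity claims are properness at the sources and at the targets.\<close>

lemma regular_bipartite_edge_colouring:
  fixes src dst :: "'x \<Rightarrow> 'a"
  assumes "finite X" "finite A" "src ` X \<subseteq> A" "dst ` X \<subseteq> A"
    and "\<And>a. a \<in> A \<Longrightarrow> card {x \<in> X. src x = a} = d"
    and "\<And>a. a \<in> A \<Longrightarrow> card {x \<in> X. dst x = a} = d"
  shows "\<exists>col. col ` X \<subseteq> {1..d} \<and> inj_on (\<lambda>x. (src x, col x)) X
     \<and> inj_on (\<lambda>x. (dst x, col x)) X"
  using assms
proof (induction d arbitrary: X)
  case 0
  have "X = {}"
  proof (rule ccontr)
    assume "X \<noteq> {}"
    then obtain x where "x \<in> X" by blast
    then have "src x \<in> A"
      using "0.prems"(3) by auto
    then have "card {y \<in> X. src y = src x} = 0"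
      by (rule "0.prems"(5))
    then show False
      using \<open>x \<in> X\<close> "0.prems"(1) by auto
  qed
  then show ?case by simp
next
  case (Suc d)
  obtain f m where f: "bij_betw f A A"
    and m: "\<forall>a\<in>A. m a \<in> X \<and> src (m a) = a \<and> dst (m a) = f a"
    by (rule regular_bipartite_perfect_matching[OF Suc.prems(1,2,4-6)])
  define M where "M = m ` A"
  have srcM: "card {x \<in> X - M. src x = a} = d" if a: "a \<in> A" for a
  proof -
    have "{x \<in> X - M. src x = a} = {x \<in> X. src x = a} - {m a}"
      using m a by (auto simp: M_def)
    then show ?thesis
      using Suc.prems(1,5) m a by (simp add: card_Diff_singleton_if)
  qed
  have dstM: "card {x \<in> X - M. dst x = b} = d" if b: "b \<in> A" for b
  proof -
    obtain a where a: "a \<in> A" "f a = b"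
      using f b by (metis bij_betw_iff_bijections)
    have "{x \<in> X - M. dst x = b} = {x \<in> X. dst x = b} - {m a}"
      using m a f by (auto simp: M_def bij_betw_def inj_on_def)
    then show ?thesis
      using Suc.prems(1,6) m a b by (simp add: card_Diff_singleton_if)
  qed
  have "\<exists>col. col ` (X - M) \<subseteq> {1..d} \<and> inj_on (\<lambda>x. (src x, col x)) (X - M)
     \<and> inj_on (\<lambda>x. (dst x, col x)) (X - M)"
    using Suc.prems(1-4) by (intro Suc.IH srcM dstM) auto
  then obtain col where col: "col ` (X - M) \<subseteq> {1..d}"
    "inj_on (\<lambda>x. (src x, col x)) (X - M)" "inj_on (\<lambda>x. (dst x, col x)) (X - M)"
    by blast
  define col' where "col' x = (if x \<in> M then Suc d else col x)" for x
  have iM: "inj_on src M" "inj_on dst M"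
    using m f by (auto simp: M_def inj_on_def bij_betw_def)
  have lt: "col x \<noteq> Suc d" if "x \<in> X" "x \<notin> M" for x
    using that col(1) by fastforce
  have "col' ` X \<subseteq> {1..Suc d}"
    using col(1) by (fastforce simp: col'_def)
  moreover have "inj_on (\<lambda>x. (src x, col' x)) X"
  proof (rule inj_onI)
    fix x y assume "x \<in> X" "y \<in> X" "(src x, col' x) = (src y, col' y)"
    then show "x = y"
      using iM(1) col(2) lt[of x] lt[of y]
      by (cases "x \<in> M"; cases "y \<in> M") (auto simp: col'_def inj_on_def)
  qed
  moreover have "inj_on (\<lambda>x. (dst x, col' x)) X"
  proof (rule inj_onI)
    fix x y assume "x \<in> X" "y \<in> X" "(dst x, col' x) = (dst y, col' y)"
    then show "x = y"
      using iM(2) col(3) lt[of x] lt[of y]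
      by (cases "x \<in> M"; cases "y \<in> M") (auto simp: col'_def inj_on_def)
  qed
  ultimately show ?case
    by blast
qed

section \<open>Routing on a path by rounds of disjoint adjacent swaps\<close>

lemma permutes_disjoint_commute:
  assumes "p permutes S" "q permutes T" "S \<inter> T = {}"
  shows "p \<circ> q = q \<circ> p"
proof
  fix x
  consider "x \<in> S" | "x \<in> T" | "x \<notin> S" "x \<notin> T" by blast
  then show "(p \<circ> q) x = (q \<circ> p) x"
  proof cases
    case 1
    then have "p x \<in> S" using assms(1) by (simp add: permutes_in_image)
    then show ?thesis using 1 assms by (metis IntI comp_apply empty_iff permutes_not_in)
  next
    case 2
    then have "q x \<in> T" using assms(2) by (simp add: permutes_in_image)
    then show ?thesis using 2 assms by (metis IntI comp_apply empty_iff permutes_not_in)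
  next
    case 3
    then show ?thesis using assms by (simp add: permutes_not_in)
  qed
qed

text \<open>A matching in the graph, encoded as the involution that exchanges the two ends of each
  of its edges.\<close>

definition swap_round :: "('a \<Rightarrow> 'a \<Rightarrow> bool) \<Rightarrow> 'a set \<Rightarrow> ('a \<Rightarrow> 'a) \<Rightarrow> bool" where
  "swap_round adj S p \<longleftrightarrow> (\<forall>v. p (p v) = v) \<and> (\<forall>v. v \<notin> S \<longrightarrow> p v = v)
     \<and> (\<forall>v\<in>S. p v = v \<or> adj v (p v))"

lemma swap_round_permutes: "swap_round adj S p \<Longrightarrow> p permutes S"
  unfolding swap_round_def permutes_def by metis

primrec run :: "(nat \<Rightarrow> 'a \<Rightarrow> 'a) \<Rightarrow> nat \<Rightarrow> 'a \<Rightarrow> 'a" where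
  "run r 0 = id"
| "run r (Suc t) = r t \<circ> run r t"

text \<open>This is what permits pipelining: \<open>r t\<close> only has to pass the rounds of
  \<open>w\<close> before time \<open>t\<close>, and then the merged schedule has the same effect as
  all of \<open>r\<close> followed by all of \<open>w\<close>.\<close>

lemma run_interleave:
  assumes "\<And>t. r t \<circ> run w t = run w t \<circ> r t"
  shows "run (\<lambda>t. w t \<circ> r t) T = run w T \<circ> run r T"
proof (induction T)
  case (Suc T)
  have "run (\<lambda>t. w t \<circ> r t) (Suc T) = w T \<circ> (r T \<circ> run w T) \<circ> run r T"
    unfolding run.simps Suc by (simp only: o_assoc)
  also have "\<dots> = run w (Suc T) \<circ> run r (Suc T)"
    by (simp only: assms run.simps o_assoc)
  finally show ?case .
qed simp

abbreviation consecutive :: "nat \<Rightarrow> nat \<Rightarrow> bool" where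
  "consecutive x y \<equiv> x = Suc y \<or> y = Suc x"

text \<open>Pipelined insertion: the item at position \<open>n\<close> starts its descent at time \<open>2 * n\<close>, when all
  swaps for smaller positions that are still to be done lie strictly below it. The bound
  on the support of \<open>r t\<close> is the invariant that keeps consecutive descents apart.\<close>

lemma path_routing_support:
  assumes "p permutes {..<n}"
  shows "\<exists>r. (\<forall>t. swap_round consecutive {..<n} (r t)) \<and>
     (\<forall>t. r t permutes {..<3 * n - 2 - t}) \<and> run r (3 * n) = p"
  using assms
proof (induction n arbitrary: p)
  case 0
  then have "p = id" by simp
  then show ?case
    by (intro exI[of _ "\<lambda>_. id"]) (auto simp: swap_round_def permutes_id)
next
  case (Suc n)
  define j where "j = p n"
  have "j \<le> n"
    using Suc.prems permutes_in_image[of p "{..<Suc n}" n] by (simp add: j_def)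
  \<comment> \<open>Within this window the descending item stands at \<open>3 * n - t\<close>: it
    leaves \<open>n\<close> at time \<open>2 * n\<close>, drops one position per round, and rests at
    \<open>j\<close> after \<open>n - j\<close> swaps.\<close>
  define w where "w t = (if 2 * n \<le> t \<and> t < 3 * n - j then transpose (3 * n - 1 - t) (3 * n - t) else id)" for t
  have w_perm: "w t permutes {..<Suc n}" for t
    using \<open>j \<le> n\<close> by (auto simp: w_def intro!: permutes_swap_id)
  have w_above: "w t permutes {3 * n - Suc t..}" for t
    by (auto simp: w_def intro!: permutes_swap_id)
  \<comment> \<open>The upper end \<open>3 * n - t\<close> of the swap is the last position below
    this bound, so the support invariant is reproduced for \<open>Suc n\<close>.\<close>
  have w_below: "w t permutes {..<3 * Suc n - 2 - t}" for t
    by (auto simp: w_def intro!: permutes_swap_id)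
  have w_round: "swap_round consecutive {..<Suc n} (w t)" for t
    using \<open>j \<le> n\<close> by (auto simp: w_def swap_round_def transpose_def)
  have run_w_above: "run w t permutes {3 * n - t..}" for t
  proof (induction t)
    case (Suc t)
    then have "run w t permutes {3 * n - Suc t..}"
      by (rule permutes_subset) auto
    then show ?case
      unfolding run.simps using w_above by (rule permutes_compose)
  qed (simp only: run.simps permutes_id)
  have run_w_perm: "run w t permutes {..<Suc n}" for t
    by (induction t) (simp_all only: run.simps permutes_id permutes_compose w_perm)
  have run_w_n: "run w t n = (if t \<le> 2 * n then n else max j (3 * n - t))" for t
  proof (induction t)
    case (Suc t)
    consider "t < 2 * n" | "2 * n \<le> t" "t < 3 * n - j" | "2 * n \<le> t" "3 * n - j \<le> t" by linarith
    then show ?case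
    proof cases
      case 1
      then have "w t = id" by (simp add: w_def)
      then show ?thesis using 1 Suc by simp
    next
      case 2
      then have "run w t n = 3 * n - t" using Suc by auto
      moreover have "w t = transpose (3 * n - 1 - t) (3 * n - t)" using 2 by (simp add: w_def)
      ultimately show ?thesis using 2 by auto
    next
      case 3
      then have "run w t n = j" using Suc \<open>j \<le> n\<close> by (auto simp: max_def)
      moreover have "w t = id" using 3 by (simp add: w_def)
      ultimately show ?thesis using 3 by (auto simp: max_def)
    qed
  qed simp
  \<comment> \<open>Since \<open>c\<close> and \<open>p\<close> agree at \<open>n\<close>, the
    quotient \<open>inv c \<circ> p\<close> fixes \<open>n\<close> and is covered by the induction
    hypothesis.\<close>
  define c where "c = run w (3 * Suc n)"
  have c: "c permutes {..<Suc n}" "c n = j"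
    using run_w_perm run_w_n[of "3 * Suc n"] by (auto simp: c_def simp del: run.simps)
  have "(inv c \<circ> p) n = n"
    using c by (metis comp_apply j_def permutes_inverses(2))
  then have "\<And>x. x \<in> {..<Suc n} - {..<n} \<Longrightarrow> (inv c \<circ> p) x = x"
    by (simp add: less_Suc_eq)
  moreover have "inv c \<circ> p permutes {..<Suc n}"
    using c(1) Suc.prems by (simp only: permutes_compose permutes_inv)
  ultimately have "inv c \<circ> p permutes {..<n}"
    by (rule permutes_superset[rotated])
  then obtain r where r: "\<And>t. swap_round consecutive {..<n} (r t)"
    "\<And>t. r t permutes {..<3 * n - 2 - t}" "run r (3 * n) = inv c \<circ> p"
    using Suc.IH by blast
  have r_id: "r t = id" if "3 * n \<le> t" for t
    using r(2)[of t] that by simp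
  have run_r: "run r (3 * Suc n) = inv c \<circ> p"
    using r(3) r_id by (simp add: numeral_3_eq_3)
  have commute: "r t \<circ> run w t = run w t \<circ> r t" for t
    by (rule permutes_disjoint_commute[OF r(2) run_w_above]) auto
  have wr_commute: "w t \<circ> r t = r t \<circ> w t" for t
    by (rule permutes_disjoint_commute[OF w_above r(2)]) auto
  define q where "q t = w t \<circ> r t" for t
  have "run q (3 * Suc n) = c \<circ> (inv c \<circ> p)"
    using run_interleave[of r w, OF commute] run_r unfolding q_def c_def by simp
  then have "run q (3 * Suc n) = p"
    using c(1) by (simp add: o_assoc permutes_inv_o)
  moreover have "q t permutes {..<3 * Suc n - 2 - t}" for t
    unfolding q_def using permutes_subset[OF r(2)[of t]] w_below
    by (intro permutes_compose) auto
  moreover have "swap_round consecutive {..<Suc n} (q t)" for t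
    unfolding swap_round_def
  proof (intro conjI allI impI ballI)
    fix x
    have "q t (q t x) = w t ((r t \<circ> w t) (r t x))"
      by (simp add: q_def)
    also have "\<dots> = w t (w t (r t (r t x)))"
      unfolding wr_commute[symmetric] by simp
    also have "\<dots> = x"
      using w_round[of t] r(1)[of t] by (simp add: swap_round_def)
    finally show "q t (q t x) = x" .
    show "q t x = x" if "x \<notin> {..<Suc n}"
      using that w_round[of t] r(1)[of t] by (simp add: q_def swap_round_def)
    show "q t x = x \<or> consecutive x (q t x)"
    proof (cases "r t x = x")
      case True
      then show ?thesis
        using w_round[of t] unfolding q_def swap_round_def comp_apply
        by (metis)
    next
      case False
      then have "x \<in> {..<3 * n - 2 - t}"
        using r(2) permutes_not_in by metis
      then have "r t x \<in> {..<3 * n - 2 - t}"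
        using r(2) by (simp only: permutes_in_image)
      then have "w t (r t x) = r t x"
        using w_above[of t] by (intro permutes_not_in) auto
      then show ?thesis
        using r(1)[of t] unfolding q_def swap_round_def comp_apply by metis
    qed
  qed
  ultimately show ?case
    by blast
qed

lemma path_routing:
  assumes "p permutes {..<n}"
  obtains r where "\<And>t. swap_round consecutive {..<n} (r t)" "run r (3 * n) = p"
  using path_routing_support[OF assms] by blast

section \<open>Composing simultaneous rotations\<close>

text \<open>One time step with the robot labels removed. The last clause says that there are no
  2-cycles, which is the ban on opposite traversals of an edge; several longer cycles may turn at
  once.\<close>

definition rotation :: "('a \<Rightarrow> 'a \<Rightarrow> bool) \<Rightarrow> 'a set \<Rightarrow> ('a \<Rightarrow> 'a) \<Rightarrow> bool" where
  "rotation adj S p \<longleftrightarrow> p permutes S \<and> (\<forall>v\<in>S. p v = v \<or> adj v (p v))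
     \<and> (\<forall>v. p (p v) = v \<longrightarrow> p v = v)"

text \<open>The step count is exact, but \<open>id\<close> is a rotation, so schedules can be padded
  to a common length. Confinement to \<open>S\<close> is what lets schedules on disjoint sets run at
  the same time.\<close>

inductive reach :: "('a \<Rightarrow> 'a \<Rightarrow> bool) \<Rightarrow> 'a set \<Rightarrow> nat \<Rightarrow> ('a \<Rightarrow> 'a) \<Rightarrow> bool"
  for adj S where
  reach_0: "reach adj S 0 id"
| reach_Suc: "reach adj S n p \<Longrightarrow> rotation adj S q \<Longrightarrow> reach adj S (Suc n) (q \<circ> p)"

lemma rotation_id: "rotation adj S id"
  by (simp add: rotation_def)

lemma rotation_subset:
  assumes "rotation adj S p" "S \<subseteq> T"
  shows "rotation adj T p"
  using assms unfolding rotation_def by (metis permutes_not_in permutes_subset)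

lemma rotation_reach: "rotation adj S p \<Longrightarrow> reach adj S 1 p"
  using reach_Suc[OF reach_0] by (simp only: comp_id One_nat_def)

lemma reach_subset: "reach adj S n p \<Longrightarrow> S \<subseteq> T \<Longrightarrow> reach adj T n p"
  by (induction rule: reach.induct) (simp_all only: reach_0 reach_Suc rotation_subset)

lemma reach_permutes: "reach adj S n p \<Longrightarrow> p permutes S"
  by (induction rule: reach.induct) (simp_all only: rotation_def permutes_id permutes_compose)

lemma reach_comp:
  assumes "reach adj S n q" "reach adj S m p"
  shows "reach adj S (m + n) (q \<circ> p)"
  using assms
proof (induction rule: reach.induct)
  case reach_0
  then show ?case by simp
next
  case (reach_Suc n q q')
  then have "reach adj S (Suc (m + n)) (q' \<circ> (q \<circ> p))"
    by (intro reach.reach_Suc)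
  then show ?case by (simp only: o_assoc add_Suc_right)
qed

lemma reach_id: "reach adj S n id"
proof (induction n)
  case (Suc n)
  then show ?case
    using reach_Suc[OF Suc rotation_id] by simp
qed (rule reach_0)

lemma reach_mono:
  assumes "reach adj S m p" "m \<le> n"
  shows "reach adj S n p"
  using reach_comp[OF reach_id assms(1), of "n - m"] assms(2) by simp

lemma reach_run:
  assumes "\<And>t. reach adj S n (r t)"
  shows "reach adj S (n * t) (run r t)"
proof (induction t)
  case (Suc t)
  then show ?case
    using reach_comp[OF assms Suc] by (simp only: run.simps mult_Suc_right add.commute)
qed (simp only: mult_0_right run.simps reach_0)

lemma permutes_disjoint_comp_apply:
  assumes "p permutes S" "q permutes T" "S \<inter> T = {}"
  shows "(p \<circ> q) v = (if v \<in> T then q v else p v)"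
proof (cases "v \<in> T")
  case True
  then have "q v \<notin> S"
    using assms(2,3) permutes_in_image by fastforce
  then show ?thesis
    using True assms(1) by (simp add: permutes_not_in)
qed (use assms(2) in \<open>simp add: permutes_not_in\<close>)

lemma rotation_disjoint_comp:
  assumes p: "rotation adj S p" and q: "rotation adj T q" and "S \<inter> T = {}"
  shows "rotation adj (S \<union> T) (p \<circ> q)"
proof -
  have perm: "p permutes S" "q permutes T"
    using p q by (auto simp: rotation_def)
  note app = permutes_disjoint_comp_apply[OF perm \<open>S \<inter> T = {}\<close>]
  have inS: "v \<in> S \<Longrightarrow> p v \<in> S" "v \<in> T \<Longrightarrow> q v \<in> T" "v \<notin> S \<Longrightarrow> p v = v" for v
    using perm by (simp_all add: permutes_in_image permutes_not_in)
  have "p \<circ> q permutes S \<union> T"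
    using permutes_subset[OF perm(1), of "S \<union> T"] permutes_subset[OF perm(2), of "S \<union> T"]
    by (intro permutes_compose) auto
  moreover have "(p \<circ> q) v = v \<or> adj v ((p \<circ> q) v)" if "v \<in> S \<union> T" for v
    unfolding app using p q that by (auto simp: rotation_def)
  moreover have "(p \<circ> q) v = v" if "(p \<circ> q) ((p \<circ> q) v) = v" for v
    using that p q inS[of v] \<open>S \<inter> T = {}\<close> unfolding app rotation_def
    by (metis IntI empty_iff)
  ultimately show ?thesis
    unfolding rotation_def by blast
qed

text \<open>Steps with disjoint supports commute, so the two schedules can be merged step by step;
  the cost is \<open>n\<close> and not \<open>2 * n\<close>.\<close>

lemma reach_disjoint_comp:
  assumes "reach adj S n p" "reach adj T n q" "S \<inter> T = {}"
  shows "reach adj (S \<union> T) n (p \<circ> q)"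
  using assms(1,2)
proof (induction n arbitrary: p q)
  case 0
  then have "p = id" "q = id"
    by (auto elim: reach.cases)
  then show ?case by (simp only: reach_0 id_comp)
next
  case (Suc n)
  obtain p1 p2 where p: "p = p2 \<circ> p1" "reach adj S n p1" "rotation adj S p2"
    using Suc.prems(1) by (cases rule: reach.cases) auto
  obtain q1 q2 where q: "q = q2 \<circ> q1" "reach adj T n q1" "rotation adj T q2"
    using Suc.prems(2) by (cases rule: reach.cases) auto
  have "q2 permutes T"
    using q(3) by (simp add: rotation_def)
  have "p \<circ> q = p2 \<circ> (p1 \<circ> q2) \<circ> q1"
    using p q by (simp only: o_assoc)
  also have "\<dots> = (p2 \<circ> q2) \<circ> (p1 \<circ> q1)"
    using permutes_disjoint_commute[OF reach_permutes[OF p(2)] \<open>q2 permutes T\<close> assms(3)]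
    by (simp only: o_assoc)
  finally show ?case
    using reach_Suc[OF Suc.IH[OF p(2) q(2)] rotation_disjoint_comp[OF p(3) q(3) assms(3)]]
    by (simp only:)
qed

lemma reach_parallel:
  assumes "finite I" "\<And>i. i \<in> I \<Longrightarrow> reach adj (B i) n (q i)"
    and "\<And>i k. i \<in> I \<Longrightarrow> k \<in> I \<Longrightarrow> i \<noteq> k \<Longrightarrow> B i \<inter> B k = {}"
    and "\<And>i v. i \<in> I \<Longrightarrow> v \<in> B i \<Longrightarrow> P v = q i v"
    and "\<And>v. v \<notin> (\<Union>i\<in>I. B i) \<Longrightarrow> P v = v"
  shows "reach adj (\<Union>i\<in>I. B i) n P"
  using assms
proof (induction I arbitrary: P)
  case empty
  then have "P = id" by auto
  then show ?case by (simp only: reach_id)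
next
  case (insert i I)
  define P' where "P' v = (if v \<in> B i then v else P v)" for v
  have disj: "B i \<inter> B k = {}" if "k \<in> I" for k
    using insert.prems(2)[of i k] insert.hyps that by blast
  have P': "reach adj (\<Union>k\<in>I. B k) n P'"
  proof (rule insert.IH)
    show "reach adj (B k) n (q k)" if "k \<in> I" for k
      using insert.prems(1) that by simp
    show "B k \<inter> B l = {}" if "k \<in> I" "l \<in> I" "k \<noteq> l" for k l
      using insert.prems(2) that by simp
    show "P' v = q k v" if "k \<in> I" "v \<in> B k" for k v
      using insert.prems(3)[of k v] that disj[of k] by (auto simp: P'_def)
    show "P' v = v" if "v \<notin> (\<Union>k\<in>I. B k)" for v
      using insert.prems(4)[of v] that by (auto simp: P'_def)
  qed
  have qi: "reach adj (B i) n (q i)"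
    using insert.prems(1) by simp
  have dj: "B i \<inter> (\<Union>k\<in>I. B k) = {}"
    using disj by blast
  have "P = q i \<circ> P'"
  proof
    fix v
    have "(q i \<circ> P') v = (if v \<in> (\<Union>k\<in>I. B k) then P' v else q i v)"
      by (rule permutes_disjoint_comp_apply[OF reach_permutes[OF qi] reach_permutes[OF P'] dj])
    also have "\<dots> = P v"
      using insert.prems(3)[of i v] insert.prems(4)[of v] dj permutes_not_in[OF reach_permutes[OF qi], of v]
      by (auto simp: P'_def)
    finally show "P v = (q i \<circ> P') v" by simp
  qed
  then show ?case
    using reach_disjoint_comp[OF qi P' dj] by (simp only: UN_insert)
qed

text \<open>As \<open>\<kappa>\<close> is constant along \<open>p\<close>, a vertex moved in its own
  class lands in that class and is left alone by all others. Treating the classes one after another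
  therefore reproduces \<open>p\<close>.\<close>

lemma reach_swap_classes:
  assumes "finite K" "\<And>v. \<kappa> (p v) = \<kappa> v"
    and "\<And>k. reach adj S n (\<lambda>v. if \<kappa> v = k then p v else v)"
  shows "reach adj S (n * card K) (\<lambda>v. if \<kappa> v \<in> K then p v else v)"
  using assms(1)
proof (induction K)
  case empty
  then show ?case using reach_0 by (simp add: id_def)
next
  case (insert k K)
  have "(\<lambda>v. if \<kappa> v \<in> insert k K then p v else v)
      = (\<lambda>v. if \<kappa> v = k then p v else v) \<circ> (\<lambda>v. if \<kappa> v \<in> K then p v else v)"
    using insert.hyps assms(2) by (auto simp: fun_eq_iff)
  then show ?case
    using reach_comp[OF assms(3)[of k] insert.IH] insert.hyps
    by (simp only: card_insert_disjoint[OF insert.hyps] mult_Suc_right add.commute)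
qed

section \<open>Swapping neighbours in a \<open>3 \<times> 2\<close> block\<close>

text \<open>Written as a product of transpositions, the cycle is a permutation by
  construction.\<close>

definition cycle4 :: "'a \<Rightarrow> 'a \<Rightarrow> 'a \<Rightarrow> 'a \<Rightarrow> 'a \<Rightarrow> 'a" where
  "cycle4 a b c d = transpose a b \<circ> transpose b c \<circ> transpose c d"

definition cycle6 :: "'a \<Rightarrow> 'a \<Rightarrow> 'a \<Rightarrow> 'a \<Rightarrow> 'a \<Rightarrow> 'a \<Rightarrow> 'a \<Rightarrow> 'a" where
  "cycle6 a b c d e f = cycle4 a b c d \<circ> transpose d e \<circ> transpose e f"

lemma cycle4_apply:
  assumes "distinct [a, b, c, d]"
  shows "cycle4 a b c d a = b" "cycle4 a b c d b = c" "cycle4 a b c d c = d" "cycle4 a b c d d = a"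
    "v \<notin> {a, b, c, d} \<Longrightarrow> cycle4 a b c d v = v"
  \<comment> \<open>The reversed list supplies each inequality in the opposite orientation as
    well.\<close>
  using assms distinct_rev[of "[a, b, c, d]"] by (simp_all add: cycle4_def)

lemma cycle6_apply:
  assumes "distinct [a, b, c, d, e, f]"
  shows "cycle6 a b c d e f a = b" "cycle6 a b c d e f b = c" "cycle6 a b c d e f c = d"
    "cycle6 a b c d e f d = e" "cycle6 a b c d e f e = f" "cycle6 a b c d e f f = a"
    "v \<notin> {a, b, c, d, e, f} \<Longrightarrow> cycle6 a b c d e f v = v"
  using assms distinct_rev[of "[a, b, c, d, e, f]"] by (simp_all add: cycle6_def cycle4_apply)

lemma rotation_cycle4:
  assumes "distinct [a, b, c, d]" "{a, b, c, d} \<subseteq> S"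
    and "adj a b" "adj b c" "adj c d" "adj d a"
  shows "rotation adj S (cycle4 a b c d)"
  unfolding rotation_def
proof (intro conjI ballI allI impI)
  show "cycle4 a b c d permutes S"
    using assms(2) unfolding cycle4_def by (intro permutes_compose permutes_swap_id) auto
  note app = cycle4_apply[OF assms(1)]
  fix v
  consider "v = a" | "v = b" | "v = c" | "v = d" | "v \<notin> {a, b, c, d}" by blast
  note cases = this
  show "cycle4 a b c d v = v \<or> adj v (cycle4 a b c d v)"
    by (cases rule: cases) (simp_all add: app assms)
  show "cycle4 a b c d v = v" if "cycle4 a b c d (cycle4 a b c d v) = v"
    using that assms(1) by (cases rule: cases) (auto simp: app)
qed

lemma rotation_cycle6:
  assumes "distinct [a, b, c, d, e, f]" "{a, b, c, d, e, f} \<subseteq> S"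
    and "adj a b" "adj b c" "adj c d" "adj d e" "adj e f" "adj f a"
  shows "rotation adj S (cycle6 a b c d e f)"
  unfolding rotation_def
proof (intro conjI ballI allI impI)
  show "cycle6 a b c d e f permutes S"
    using assms(2) unfolding cycle6_def cycle4_def
    by (intro permutes_compose permutes_swap_id) auto
  note app = cycle6_apply[OF assms(1)]
  fix v
  consider "v = a" | "v = b" | "v = c" | "v = d" | "v = e" | "v = f" | "v \<notin> {a, b, c, d, e, f}"
    by blast
  note cases = this
  show "cycle6 a b c d e f v = v \<or> adj v (cycle6 a b c d e f v)"
    by (cases rule: cases) (simp_all add: app assms)
  show "cycle6 a b c d e f v = v" if "cycle6 a b c d e f (cycle6 a b c d e f v) = v"
    using that assms(1) by (cases rule: cases) (auto simp: app)
qed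

text \<open>In the ladder with rows \<open>a b c\<close> and \<open>d e f\<close>, rotating both squares and then the outer cycle
  backwards leaves only \<open>e\<close> and \<open>f\<close> exchanged; conjugating by a square gives the rungs.\<close>

lemma reach_ladder_swaps:
  assumes dist: "distinct [a, b, c, d, e, f]" and sub: "{a, b, c, d, e, f} \<subseteq> S"
    and sym: "\<And>u v. adj u v \<Longrightarrow> adj v u"
    and adj: "adj a b" "adj b c" "adj d e" "adj e f" "adj a d" "adj b e" "adj c f"
  shows "reach adj S 5 (transpose e f)" "reach adj S 5 (transpose b e)"
    "reach adj S 5 (transpose c f)"
proof -
  note adj' = adj adj[THEN sym]
  have dL: "distinct [a, b, e, d]" and dR: "distinct [b, c, f, e]" and dR': "distinct [b, e, f, c]"
    and dO: "distinct [a, d, e, f, c, b]"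
    using dist by auto
  have L: "reach adj S 1 (cycle4 a b e d)"
    using sub by (intro rotation_reach rotation_cycle4 dL adj') auto
  have R: "reach adj S 1 (cycle4 b c f e)"
    using sub by (intro rotation_reach rotation_cycle4 dR adj') auto
  have R': "reach adj S 1 (cycle4 b e f c)"
    using sub by (intro rotation_reach rotation_cycle4 dR' adj') auto
  have O': "reach adj S 1 (cycle6 a d e f c b)"
    using sub by (intro rotation_reach rotation_cycle6 dO adj') auto
  note app = cycle4_apply[OF dL] cycle4_apply[OF dR] cycle4_apply[OF dR'] cycle6_apply[OF dO]
  \<comment> \<open>The rotation \<open>cycle4 b c f e\<close> carries the edge \<open>e f\<close>
    to \<open>b e\<close>, and its inverse \<open>cycle4 b e f c\<close> carries it to
    \<open>c f\<close>; hence the two conjugations.\<close>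
  have eqs: "transpose e f = cycle6 a d e f c b \<circ> (cycle4 a b e d \<circ> cycle4 b c f e)"
    "transpose b e = cycle4 b c f e \<circ> (transpose e f \<circ> cycle4 b e f c)"
    "transpose c f = cycle4 b e f c \<circ> (transpose e f \<circ> cycle4 b c f e)"
  proof -
    have "transpose e f v = (cycle6 a d e f c b \<circ> (cycle4 a b e d \<circ> cycle4 b c f e)) v \<and>
      transpose b e v = (cycle4 b c f e \<circ> (transpose e f \<circ> cycle4 b e f c)) v \<and>
      transpose c f v = (cycle4 b e f c \<circ> (transpose e f \<circ> cycle4 b c f e)) v" for v
    proof -
      consider "v = a" | "v = b" | "v = c" | "v = d" | "v = e" | "v = f"
        | "v \<notin> {a, b, c, d, e, f}"
        by blast
      then show ?thesis
        using dist distinct_rev[of "[a, b, c, d, e, f]"] by cases (simp_all add: app)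
    qed
    then show "transpose e f = cycle6 a d e f c b \<circ> (cycle4 a b e d \<circ> cycle4 b c f e)"
      "transpose b e = cycle4 b c f e \<circ> (transpose e f \<circ> cycle4 b e f c)"
      "transpose c f = cycle4 b e f c \<circ> (transpose e f \<circ> cycle4 b c f e)"
      by (intro ext; blast)+
  qed
  \<comment> \<open>Three rotations suffice here, and conjugation adds two: 5 is the common
    bound.\<close>
  have 3: "reach adj S 3 (transpose e f)"
    unfolding eqs(1) by (rule reach_mono[OF reach_comp[OF O' reach_comp[OF L R]]]) simp
  then show "reach adj S 5 (transpose e f)"
    by (rule reach_mono) simp
  show "reach adj S 5 (transpose b e)"
    unfolding eqs(2) by (rule reach_mono[OF reach_comp[OF R reach_comp[OF 3 R']]]) simp
  show "reach adj S 5 (transpose c f)"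
    unfolding eqs(3) by (rule reach_mono[OF reach_comp[OF R' reach_comp[OF 3 R]]]) simp
qed

text \<open>The long side lies along the first coordinate, the one guaranteed to take at least three
  values.\<close>

definition block :: "nat \<Rightarrow> nat \<Rightarrow> (nat \<times> nat) set" where
  "block i j = {i..i + 2} \<times> {j..j + 1}"

lemma grid_adj_iff:
  "grid_adj ml ms u v \<longleftrightarrow> u \<in> grid_vertices ml ms \<and> v \<in> grid_vertices ml ms \<and>
     (fst u = fst v \<and> consecutive (snd u) (snd v) \<or> snd u = snd v \<and> consecutive (fst u) (fst v))"
proof -
  have "(if a \<le> c then c - a else a - c) + (if b \<le> d then d - b else b - d) = 1 \<longleftrightarrow>
      a = c \<and> consecutive b d \<or> b = d \<and> consecutive a c" for a b c d :: nat
    by (cases "a \<le> c"; cases "b \<le> d"; simp; linarith)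
  then show ?thesis
    unfolding grid_adj_def by blast
qed

lemma grid_adj_sym: "grid_adj ml ms u v \<Longrightarrow> grid_adj ml ms v u"
  unfolding grid_adj_iff by metis

lemma reach_block_swap:
  assumes "1 \<le> i" "i + 2 \<le> ml" "1 \<le> j" "j + 1 \<le> ms"
    and "u \<in> block i j" "v \<in> block i j" "grid_adj ml ms u v"
  shows "reach (grid_adj ml ms) (block i j) 5 (transpose u v)"
proof -
  let ?reach = "\<lambda>u v. reach (grid_adj ml ms) (block i j) 5 (transpose u v)"
  have ladder: "?reach (x', y') (x'', y') \<and> ?reach (x', y) (x', y') \<and> ?reach (x'', y) (x'', y')"
    if x: "x' = i + 1" "x = i \<and> x'' = i + 2 \<or> x = i + 2 \<and> x'' = i"
      and y: "y = j \<and> y' = j + 1 \<or> y = j + 1 \<and> y' = j" for x x' x'' y y'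
  proof -
    have *: "distinct [(x, y), (x', y), (x'', y), (x, y'), (x', y'), (x'', y')]"
      "{(x, y), (x', y), (x'', y), (x, y'), (x', y'), (x'', y')} \<subseteq> block i j"
      using x y by (auto simp: block_def)
    have **: "grid_adj ml ms (x, y) (x', y)" "grid_adj ml ms (x', y) (x'', y)"
      "grid_adj ml ms (x, y') (x', y')" "grid_adj ml ms (x', y') (x'', y')"
      "grid_adj ml ms (x, y) (x, y')" "grid_adj ml ms (x', y) (x', y')"
      "grid_adj ml ms (x'', y) (x'', y')"
      using x y assms(1-4) by (auto simp: grid_adj_iff grid_vertices_def)
    show ?thesis
      using reach_ladder_swaps[OF * grid_adj_sym **] by blast
  qed
  have sym: "?reach u v \<Longrightarrow> ?reach v u" for u v
    by (simp only: transpose_commute)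
  define edges where "edges = {((i, j), (i + 1, j)), ((i + 1, j), (i + 2, j)),
    ((i, j + 1), (i + 1, j + 1)), ((i + 1, j + 1), (i + 2, j + 1)),
    ((i, j), (i, j + 1)), ((i + 1, j), (i + 1, j + 1)), ((i + 2, j), (i + 2, j + 1))}"
  have edges: "?reach u v" if "(u, v) \<in> edges" for u v
    using that ladder[of "i + 1" i "i + 2" j "j + 1"] ladder[of "i + 1" i "i + 2" "j + 1" j]
      ladder[of "i + 1" "i + 2" i j "j + 1", simplified, THEN conjunct1, THEN sym]
      ladder[of "i + 1" "i + 2" i j "j + 1"]
      ladder[of "i + 1" "i + 2" i "j + 1" j, simplified, THEN conjunct1, THEN sym]
    unfolding edges_def by auto
  have cases: "w = (i, j) \<or> w = (i + 1, j) \<or> w = (i + 2, j) \<or> w = (i, j + 1) \<or> w = (i + 1, j + 1)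
      \<or> w = (i + 2, j + 1)" if "w \<in> block i j" for w
  proof -
    have "fst w = i \<or> fst w = i + 1 \<or> fst w = i + 2" "snd w = j \<or> snd w = j + 1"
      using that by (auto simp: block_def)
    then show ?thesis
      by (cases w) auto
  qed
  have "(u, v) \<in> edges \<or> (v, u) \<in> edges"
    using cases[OF assms(5)] cases[OF assms(6)] assms(7) unfolding edges_def
    by (elim disjE) (simp_all add: grid_adj_iff)
  then show ?thesis
    using edges sym by blast
qed

text \<open>The \<open>3 \<times> 2\<close> block assigned to an edge \<open>uv\<close>, pushed back into the grid at the upper boundary,
  and the class of the edge: the residues make blocks of one class disjoint, the last two
  components fix the position of the edge inside its block.\<close>

definition edge_block :: "nat \<Rightarrow> nat \<Rightarrow> nat \<times> nat \<Rightarrow> nat \<times> nat \<Rightarrow> nat \<times> nat" where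
  "edge_block ml ms u v = (min (ml - 2) (min (fst u) (fst v)), min (ms - 1) (min (snd u) (snd v)))"

definition edge_class :: "nat \<Rightarrow> nat \<Rightarrow> nat \<times> nat \<Rightarrow> nat \<times> nat \<Rightarrow> nat \<times> nat \<times> nat \<times> nat" where
  "edge_class ml ms u v = (case edge_block ml ms u v of (i, j) \<Rightarrow>
     (i mod 3, j mod 2, fst u + fst v - 2 * i, snd u + snd v - 2 * j))"

lemma edge_block_commute: "edge_block ml ms u v = edge_block ml ms v u"
  by (simp add: edge_block_def min.commute)

lemma edge_class_commute: "edge_class ml ms u v = edge_class ml ms v u"
  by (simp add: edge_class_def edge_block_commute[of ml ms u] add.commute)

lemma edge_block_properties:
  assumes "3 \<le> ml" "2 \<le> ms" "grid_adj ml ms u v" "edge_block ml ms u v = (i, j)"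
  shows "1 \<le> i" "i + 2 \<le> ml" "1 \<le> j" "j + 1 \<le> ms" "u \<in> block i j" "v \<in> block i j"
    "edge_class ml ms u v \<in> {..<3} \<times> {..<2} \<times> {..<5} \<times> {..<3}"
proof -
  obtain a b c d where uv: "u = (a, b)" "v = (c, d)"
    by fastforce
  have ij: "i = min (ml - 2) (min a c)" "j = min (ms - 1) (min b d)"
    using assms(4) by (auto simp: edge_block_def uv)
  have bounds: "1 \<le> a" "a \<le> ml" "1 \<le> c" "c \<le> ml" "1 \<le> b" "b \<le> ms" "1 \<le> d" "d \<le> ms"
    "c \<le> a + 1" "a \<le> c + 1" "b \<le> d + 1" "d \<le> b + 1"
    using assms(3) by (auto simp: grid_adj_iff grid_vertices_def uv)
  show "1 \<le> i" "i + 2 \<le> ml" "1 \<le> j" "j + 1 \<le> ms"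
    using bounds assms(1,2) unfolding ij by linarith+
  have le: "i \<le> a" "i \<le> c" "j \<le> b" "j \<le> d" "a \<le> i + 2" "c \<le> i + 2" "b \<le> j + 1" "d \<le> j + 1"
    using bounds assms(1,2) unfolding ij by linarith+
  then show "u \<in> block i j" "v \<in> block i j"
    by (auto simp: block_def uv)
  \<comment> \<open>Inside the block each endpoint has offsets at most 2 and 1, so the sums over two
    endpoints are at most 4 and 2.\<close>
  have "a + c - 2 * i < 5" "b + d - 2 * j < 3"
    using le by linarith+
  then show "edge_class ml ms u v \<in> {..<3} \<times> {..<2} \<times> {..<5} \<times> {..<3}"
    using assms(4) by (simp add: edge_class_def uv)
qed

text \<open>An edge is determined by the sum of its endpoints, that is, by its midpoint: the
  coordinate with odd sum is its direction. The class records this sum relative to the corner of the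
  block.\<close>

lemma edge_unique_in_class:
  assumes "3 \<le> ml" "2 \<le> ms" "grid_adj ml ms u v" "grid_adj ml ms u' v'"
    and "edge_block ml ms u v = edge_block ml ms u' v'" "edge_class ml ms u v = edge_class ml ms u' v'"
  shows "u' = u \<or> u' = v"
proof -
  obtain a b c d a' b' c' d' where uv: "u = (a, b)" "v = (c, d)" "u' = (a', b')" "v' = (c', d')"
    by (metis surj_pair)
  obtain i j where ij: "edge_block ml ms u v = (i, j)"
    by fastforce
  \<comment> \<open>These bounds rule out truncation in the subtractions of
    \<open>edge_class\<close>, so equal differences give equal sums.\<close>
  have "i \<le> a" "i \<le> c" "i \<le> a'" "i \<le> c'" "j \<le> b" "j \<le> d" "j \<le> b'" "j \<le> d'"
    using edge_block_properties(5,6)[OF assms(1-3) ij]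
      edge_block_properties(5,6)[OF assms(1,2,4), of i j] ij assms(5)
    by (auto simp: uv block_def)
  moreover have "a + c - 2 * i = a' + c' - 2 * i" "b + d - 2 * j = b' + d' - 2 * j"
    using assms(5,6) ij by (auto simp: edge_class_def uv)
  ultimately have "a + c = a' + c'" "b + d = b' + d'"
    by linarith+
  moreover have "a = c \<and> consecutive b d \<or> b = d \<and> consecutive a c"
    "a' = c' \<and> consecutive b' d' \<or> b' = d' \<and> consecutive a' c'"
    using assms(3,4) by (auto simp: grid_adj_iff uv)
  ultimately have "a' = a \<and> b' = b \<or> a' = c \<and> b' = d"
    by (elim disjE conjE; clarsimp; presburger)
  then show ?thesis
    by (auto simp: uv)
qed

text \<open>The moduli are the side lengths of a block: corners of blocks with a common vertex
  differ by at most 2 and 1, so congruent corners coincide.\<close>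

lemma block_disjoint:
  assumes "i mod 3 = i' mod 3" "j mod 2 = j' mod 2" "v \<in> block i j" "v \<in> block i' j'"
  shows "i = i' \<and> j = j'"
proof -
  have i: "i \<le> i' + 2" "i' \<le> i + 2" and j: "j \<le> j' + 1" "j' \<le> j + 1"
    using assms(3,4) by (auto simp: block_def)
  have "i = i'"
    using i assms(1) by presburger
  moreover have "j = j'"
    using j assms(2) by presburger
  ultimately show ?thesis ..
qed

lemma swap_round_reach:
  assumes ml: "3 \<le> ml" and ms: "2 \<le> ms"
    and p: "swap_round (grid_adj ml ms) (grid_vertices ml ms) p"
  shows "reach (grid_adj ml ms) (grid_vertices ml ms) 450 p"
proof -
  let ?V = "grid_vertices ml ms" and ?adj = "grid_adj ml ms"
  \<comment> \<open>At a fixed vertex there is no edge and the value is meaningless, but harmless: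
    such a vertex stays put in whichever class it falls.\<close>
  define \<kappa> where "\<kappa> v = edge_class ml ms v (p v)" for v
  have pp: "p (p v) = v" for v
    using p unfolding swap_round_def by blast
  have adj: "?adj v (p v)" if "p v \<noteq> v" for v
    using p that unfolding swap_round_def by blast
  have \<kappa>_p: "\<kappa> (p v) = \<kappa> v" for v
    by (simp add: \<kappa>_def pp edge_class_commute)
  have "reach ?adj ?V 5 (\<lambda>v. if \<kappa> v = k then p v else v)" for k
  proof -
    obtain \<alpha> \<beta> k' where k: "k = (\<alpha>, \<beta>, k')"
      by (metis surj_pair)
    define P where "P v = (if \<kappa> v = k then p v else v)" for v
    define I where "I = {(i, j). 1 \<le> i \<and> i + 2 \<le> ml \<and> 1 \<le> j \<and> j + 1 \<le> ms \<and> i mod 3 = \<alpha> \<and> j mod 2 = \<beta>}"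
    define B where "B = (\<lambda>(i, j). block i j)"
    have fin: "finite I"
      by (rule finite_subset[of _ "{..ml} \<times> {..ms}"]) (auto simp: I_def)
    have moved: "\<kappa> w = k \<and> ?adj w (p w) \<and> edge_block ml ms w (p w) \<in> I \<and>
        w \<in> B (edge_block ml ms w (p w)) \<and> p w \<in> B (edge_block ml ms w (p w))"
      if "P w \<noteq> w" for w
    proof -
      obtain i j where ij: "edge_block ml ms w (p w) = (i, j)"
        by fastforce
      have "\<kappa> w = k" "p w \<noteq> w"
        using that by (auto simp: P_def split: if_splits)
      then show ?thesis
        using edge_block_properties[OF ml ms adj ij] adj[of w] ij
        by (auto simp: I_def B_def k \<kappa>_def edge_class_def)
    qed
    have same: "x = y" if "x \<in> I" "y \<in> I" "v \<in> B x" "v \<in> B y" for x y v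
    proof -
      obtain i j i' j' where "x = (i, j)" "y = (i', j')"
        by fastforce
      then show ?thesis
        using that block_disjoint[of i i' j j' v] by (auto simp: I_def B_def)
    qed
    have "reach ?adj (\<Union>x\<in>I. B x) 5 P"
    proof (rule reach_parallel[where q = "\<lambda>x v. if v \<in> B x then P v else v"])
      show "finite I" by fact
      show "B x \<inter> B y = {}" if "x \<in> I" "y \<in> I" "x \<noteq> y" for x y
        using same that by blast
      show "P v = v" if "v \<notin> (\<Union>x\<in>I. B x)" for v
        using moved[of v] that by blast
      show "P v = (if v \<in> B x then P v else v)" if "v \<in> B x" for x v
        using that by simp
      fix x assume x: "x \<in> I"
      obtain i j where ij: "x = (i, j)"
        by fastforce
      show "reach ?adj (B x) 5 (\<lambda>v. if v \<in> B x then P v else v)"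
      proof (cases "\<exists>w\<in>B x. P w \<noteq> w")
        case False
        then have "(\<lambda>v. if v \<in> B x then P v else v) = id"
          by auto
        then show ?thesis
          by (simp only: reach_id)
      next
        case True
        then obtain w where w: "w \<in> B x" "P w \<noteq> w"
          by blast
        note mw = moved[OF w(2)]
        have bw: "edge_block ml ms w (p w) = x"
          using same[of "edge_block ml ms w (p w)" x w] mw x w by blast
        have "(\<lambda>v. if v \<in> B x then P v else v) = transpose w (p w)"
        proof
          fix v
          consider "v = w" | "v = p w" | "v \<noteq> w" "v \<noteq> p w" by blast
          then show "(if v \<in> B x then P v else v) = transpose w (p w) v"
          proof cases
            case 1
            then show ?thesis using w mw by (simp add: P_def)
          next
            case 2
            then show ?thesis using mw bw by (simp add: P_def \<kappa>_p pp)
          next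
            case 3
            \<comment> \<open>Another moved vertex of this block would lie on an edge with the same
              block and class, hence on the edge from \<open>w\<close> to \<open>p w\<close>. So
              each block performs at most one swap.\<close>
            have "P v = v" if "v \<in> B x"
            proof (rule ccontr)
              assume v: "P v \<noteq> v"
              note mv = moved[OF v]
              have "edge_block ml ms v (p v) = x"
                using same[of "edge_block ml ms v (p v)" x v] mv x that by blast
              then have "v = w \<or> v = p w"
                using edge_unique_in_class[OF ml ms, of w "p w" v "p v"] mw mv bw
                by (simp add: \<kappa>_def)
              then show False using 3 by blast
            qed
            then show ?thesis using 3 by simp
          qed
        qed
        moreover have "reach ?adj (B x) 5 (transpose w (p w))"
          using reach_block_swap[of i ml j ms w "p w"] x mw bw
          by (auto simp: I_def B_def ij)
        ultimately show ?thesis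
          by (simp only:)
      qed
    qed
    moreover have "(\<Union>x\<in>I. B x) \<subseteq> ?V"
      by (auto simp: I_def B_def block_def grid_vertices_def)
    ultimately have "reach ?adj ?V 5 P"
      by (rule reach_subset)
    then show ?thesis
      unfolding P_def .
  qed
  note classes = reach_swap_classes[OF _ \<kappa>_p this]
  define K :: "(nat \<times> nat \<times> nat \<times> nat) set" where "K = {..<3} \<times> {..<2} \<times> {..<5} \<times> {..<3}"
  have "(\<lambda>v. if \<kappa> v \<in> K then p v else v) = p"
  proof
    fix v
    show "(if \<kappa> v \<in> K then p v else v) = p v"
      using edge_block_properties(7)[OF ml ms adj[of v] surjective_pairing]
      by (cases "p v = v") (simp_all add: \<kappa>_def K_def)
  qed
  moreover have "finite K" "5 * card K = 450"
    by (simp_all add: K_def card_cartesian_product)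
  ultimately show ?thesis
    using classes[of K] by (simp only:)
qed

section \<open>Routing along the lines of the grid\<close>

text \<open>\<open>line\<close> and \<open>pos\<close> are coordinates with inverse
  \<open>emb\<close>, so that both directions of the grid share one proof. Round \<open>t\<close> of
  every line is merged into a single round of the grid; hence the number of lines does not enter the
  bound.\<close>

lemma reach_line_permutation:
  fixes line :: "nat \<times> nat \<Rightarrow> 'i" and pos :: "nat \<times> nat \<Rightarrow> nat" and emb :: "'i \<Rightarrow> nat \<Rightarrow> nat \<times> nat"
  assumes ml: "3 \<le> ml" and ms: "2 \<le> ms"
    and V: "\<And>v. v \<in> grid_vertices ml ms \<Longrightarrow> emb (line v) (pos v) = v \<and> line v \<in> I \<and> pos v < n"
    and emb: "\<And>i k. i \<in> I \<Longrightarrow> k < n \<Longrightarrow> emb i k \<in> grid_vertices ml ms \<and> line (emb i k) = i \<and> pos (emb i k) = k"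
    and adj: "\<And>i k. i \<in> I \<Longrightarrow> Suc k < n \<Longrightarrow> grid_adj ml ms (emb i k) (emb i (Suc k))"
    and \<sigma>: "\<sigma> permutes grid_vertices ml ms" "\<And>v. v \<in> grid_vertices ml ms \<Longrightarrow> line (\<sigma> v) = line v"
  shows "reach (grid_adj ml ms) (grid_vertices ml ms) (450 * (3 * n)) \<sigma>"
proof -
  let ?V = "grid_vertices ml ms"
  have \<sigma>V: "\<sigma> v \<in> ?V \<longleftrightarrow> v \<in> ?V" for v
    using \<sigma>(1) by (simp add: permutes_in_image)
  define p where "p i k = (if k < n then pos (\<sigma> (emb i k)) else k)" for i k
  have emb_p: "emb i (p i k) = \<sigma> (emb i k) \<and> p i k < n" if "i \<in> I" "k < n" for i k
    using emb[OF that] V[of "\<sigma> (emb i k)"] \<sigma>V[of "emb i k"] \<sigma>(2)[of "emb i k"] that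
    by (auto simp: p_def)
  have p_perm: "p i permutes {..<n}" if "i \<in> I" for i
  proof (rule bij_imp_permutes)
    have "inj_on (p i) {..<n}"
    proof (rule inj_onI)
      fix k l assume kl: "k \<in> {..<n}" "l \<in> {..<n}" "p i k = p i l"
      then have "\<sigma> (emb i k) = \<sigma> (emb i l)"
        using emb_p that by (metis lessThan_iff)
      then have "emb i k = emb i l"
        using permutes_inj[OF \<sigma>(1)] by (simp add: inj_eq)
      then show "k = l"
        using emb[OF that] kl by (metis lessThan_iff)
    qed
    moreover have "p i ` {..<n} \<subseteq> {..<n}"
      using emb_p that by auto
    ultimately show "bij_betw (p i) {..<n} {..<n}"
      by (simp add: bij_betw_def endo_inj_surj)
  qed (simp add: p_def)
  have "\<forall>i\<in>I. \<exists>r. (\<forall>t. swap_round consecutive {..<n} (r t)) \<and> run r (3 * n) = p i"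
  proof
    fix i assume "i \<in> I"
    show "\<exists>r. (\<forall>t. swap_round consecutive {..<n} (r t)) \<and> run r (3 * n) = p i"
      by (rule path_routing[OF p_perm[OF \<open>i \<in> I\<close>]]) blast
  qed
  from bchoice[OF this] obtain r
    where r: "\<forall>i\<in>I. (\<forall>t. swap_round consecutive {..<n} (r i t)) \<and> run (r i) (3 * n) = p i"
    by blast
  have rn: "r i t k < n" if "i \<in> I" "k < n" for i t k
  proof -
    have "r i t permutes {..<n}"
      using r that(1) swap_round_permutes by blast
    then show ?thesis
      using permutes_in_image[of "r i t" "{..<n}" k] that(2) by simp
  qed
  define R where "R t v = (if v \<in> ?V then emb (line v) (r (line v) t (pos v)) else v)" for t v
  have R: "R t v \<in> ?V \<and> line (R t v) = line v \<and> pos (R t v) = r (line v) t (pos v)" if "v \<in> ?V" for t v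
    using that V[OF that] rn emb by (simp add: R_def)
  have "swap_round (grid_adj ml ms) ?V (R t)" for t
    unfolding swap_round_def
  proof (intro conjI allI ballI impI)
    fix v
    show "R t v = v" if "v \<notin> ?V"
      using that by (simp add: R_def)
    show "R t (R t v) = v"
    proof (cases "v \<in> ?V")
      case True
      then have "R t (R t v) = emb (line v) (r (line v) t (r (line v) t (pos v)))"
        using R[OF True, of t] by (simp add: R_def[of t "R t v"])
      also have "\<dots> = v"
        using r V[OF True] by (simp add: swap_round_def)
      finally show ?thesis .
    qed (simp add: R_def)
    assume v: "v \<in> ?V"
    let ?k = "r (line v) t (pos v)"
    have k: "?k = pos v \<or> consecutive (pos v) ?k"
      using r V[OF v] unfolding swap_round_def by blast
    have "?k < n"
      using rn V[OF v] by blast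
    have "R t v = emb (line v) ?k"
      using v by (simp add: R_def)
    then show "R t v = v \<or> grid_adj ml ms v (R t v)"
      using k adj[of "line v" ?k] adj[of "line v" "pos v"] V[OF v] \<open>?k < n\<close> grid_adj_sym
      by metis
  qed
  then have "reach (grid_adj ml ms) ?V (450 * (3 * n)) (run R (3 * n))"
    by (intro reach_run swap_round_reach ml ms)
  moreover have runV: "run R t v \<in> ?V \<and> line (run R t v) = line v \<and> pos (run R t v) = run (r (line v)) t (pos v)"
    if "v \<in> ?V" for t v
    by (induction t) (use that R in simp_all)
  have "run R (3 * n) = \<sigma>"
  proof
    fix v
    show "run R (3 * n) v = \<sigma> v"
    proof (cases "v \<in> ?V")
      case True
      then have "run R (3 * n) v = emb (line v) (p (line v) (pos v))"
        using V[of "run R (3 * n) v"] runV[OF True, of "3 * n"] r V[OF True] by metis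
      then show ?thesis
        using emb_p V[OF True] by simp
    next
      case False
      have "run R t v = v" for t
        by (induction t) (use False in \<open>simp_all add: R_def\<close>)
      then show ?thesis
        using False \<sigma>(1) by (simp add: permutes_not_in)
    qed
  qed
  ultimately show ?thesis
    by (simp only:)
qed

lemma reach_fst_preserving:
  assumes "3 \<le> ml" "2 \<le> ms" "\<sigma> permutes grid_vertices ml ms"
    and "\<And>v. v \<in> grid_vertices ml ms \<Longrightarrow> fst (\<sigma> v) = fst v"
  shows "reach (grid_adj ml ms) (grid_vertices ml ms) (450 * (3 * ms)) \<sigma>"
  \<comment> \<open>Grid coordinates start at 1 and path positions at 0, hence the shift.\<close>
  by (rule reach_line_permutation[where line = fst and pos = "\<lambda>v. snd v - 1" and I = "{1..ml}"
        and emb = "\<lambda>i k. (i, Suc k)"])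
    (use assms in \<open>auto simp: grid_vertices_def grid_adj_iff\<close>)

lemma reach_snd_preserving:
  assumes "3 \<le> ml" "2 \<le> ms" "\<sigma> permutes grid_vertices ml ms"
    and "\<And>v. v \<in> grid_vertices ml ms \<Longrightarrow> snd (\<sigma> v) = snd v"
  shows "reach (grid_adj ml ms) (grid_vertices ml ms) (450 * (3 * ml)) \<sigma>"
  by (rule reach_line_permutation[where line = snd and pos = "\<lambda>v. fst v - 1" and I = "{1..ms}"
        and emb = "\<lambda>i k. (Suc k, i)"])
    (use assms in \<open>auto simp: grid_vertices_def grid_adj_iff\<close>)

section \<open>Routing arbitrary permutations\<close>

text \<open>Here \<open>f\<close> and \<open>g\<close> are two placements of the same objects, and
  \<open>\<sigma>\<close> is the rearrangement that turns the one into the other.\<close>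

lemma permutes_factor:
  assumes "bij_betw f S S" "bij_betw g S S"
  obtains \<sigma> where "\<sigma> permutes S" "\<And>x. x \<in> S \<Longrightarrow> \<sigma> (f x) = g x"
proof -
  define \<sigma> where "\<sigma> x = (if x \<in> S then g (inv_into S f x) else x)" for x
  have "bij_betw (g \<circ> inv_into S f) S S"
    using assms bij_betw_inv_into bij_betw_trans by blast
  then have "bij_betw \<sigma> S S"
    by (rule bij_betw_cong[THEN iffD1, rotated]) (simp add: \<sigma>_def)
  then have "\<sigma> permutes S"
    by (rule bij_imp_permutes) (simp add: \<sigma>_def)
  moreover have "\<sigma> (f x) = g x" if "x \<in> S" for x
    using assms(1) that by (simp add: \<sigma>_def bij_betw_inv_into_left bij_betwE)
  ultimately show ?thesis
    using that by blast
qed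

text \<open>Colour each vertex \<open>v\<close>, seen as an edge from the line of \<open>v\<close> to the line of \<open>\<pi> v\<close>, properly;
  the colour is the second coordinate at which \<open>v\<close> changes lines.\<close>

lemma reach_any_permutation:
  assumes ml: "3 \<le> ml" and ms: "2 \<le> ms" and \<pi>: "\<pi> permutes grid_vertices ml ms"
  shows "reach (grid_adj ml ms) (grid_vertices ml ms) (1350 * (ml + 2 * ms)) \<pi>"
proof -
  let ?V = "grid_vertices ml ms"
  have fin: "finite ?V"
    by (simp add: grid_vertices_def)
  have \<pi>V: "\<pi> v \<in> ?V \<longleftrightarrow> v \<in> ?V" for v
    using \<pi> by (simp add: permutes_in_image)
  have src: "card {v \<in> ?V. fst v = a} = ms" if "a \<in> {1..ml}" for a
  proof -
    have "{v \<in> ?V. fst v = a} = {a} \<times> {1..ms}"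
      using that by (auto simp: grid_vertices_def)
    then show ?thesis by (simp add: card_cartesian_product)
  qed
  have dst: "card {v \<in> ?V. fst (\<pi> v) = a} = ms" if "a \<in> {1..ml}" for a
  proof -
    have "\<pi> ` {v \<in> ?V. fst (\<pi> v) = a} = {v \<in> ?V. fst v = a}"
    proof (intro equalityI subsetI)
      fix w assume w: "w \<in> {v \<in> ?V. fst v = a}"
      then have "w = \<pi> (inv \<pi> w)"
        using permutes_inverses(1)[OF \<pi>] by simp
      then show "w \<in> \<pi> ` {v \<in> ?V. fst (\<pi> v) = a}"
        using w \<pi>V[of "inv \<pi> w"] by (intro image_eqI[of _ _ "inv \<pi> w"]) simp_all
    qed (use \<pi>V in auto)
    moreover have "inj_on \<pi> {v \<in> ?V. fst (\<pi> v) = a}"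
      using permutes_inj[OF \<pi>] by (rule inj_on_subset) simp
    ultimately show ?thesis
      using src[OF that] card_image[of \<pi> "{v \<in> ?V. fst (\<pi> v) = a}"] by simp
  qed
  have fst_V: "fst v \<in> {1..ml}" if "v \<in> ?V" for v
    using that by (auto simp: grid_vertices_def)
  then have ranges: "fst ` ?V \<subseteq> {1..ml}" "(\<lambda>v. fst (\<pi> v)) ` ?V \<subseteq> {1..ml}"
    using \<pi>V by blast+
  \<comment> \<open>All degrees are \<open>ms\<close>, so there are as many colours as second
    coordinates. Properness at the sources keeps robots apart after the initial phase, properness at
    the targets after the middle one.\<close>
  obtain col where col: "col ` ?V \<subseteq> {1..ms}" "inj_on (\<lambda>v. (fst v, col v)) ?V"
    "inj_on (\<lambda>v. (fst (\<pi> v), col v)) ?V"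
    using regular_bipartite_edge_colouring[OF fin finite_atLeastAtMost ranges src dst] by blast
  have bij1: "bij_betw (\<lambda>v. (fst v, col v)) ?V ?V"
  proof (intro bij_betw_imageI endo_inj_surj fin col(2))
    show "(\<lambda>v. (fst v, col v)) ` ?V \<subseteq> ?V"
      using col(1) fst_V by (auto simp: image_subset_iff grid_vertices_def)
  qed
  have bij2: "bij_betw (\<lambda>v. (fst (\<pi> v), col v)) ?V ?V"
  proof (intro bij_betw_imageI endo_inj_surj fin col(3))
    show "(\<lambda>v. (fst (\<pi> v), col v)) ` ?V \<subseteq> ?V"
      using col(1) fst_V \<pi>V by (auto simp: image_subset_iff grid_vertices_def)
  qed
  have bij3: "bij_betw \<pi> ?V ?V"
    using \<pi> by (rule permutes_imp_bij)
  obtain \<sigma>1 where \<sigma>1: "\<sigma>1 permutes ?V" "\<And>v. v \<in> ?V \<Longrightarrow> \<sigma>1 v = (fst v, col v)"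
    using permutes_factor[OF bij_betw_id bij1] by auto
  obtain \<sigma>2 where \<sigma>2: "\<sigma>2 permutes ?V" "\<And>v. v \<in> ?V \<Longrightarrow> \<sigma>2 (fst v, col v) = (fst (\<pi> v), col v)"
    using permutes_factor[OF bij1 bij2] by auto
  obtain \<sigma>3 where \<sigma>3: "\<sigma>3 permutes ?V" "\<And>v. v \<in> ?V \<Longrightarrow> \<sigma>3 (fst (\<pi> v), col v) = \<pi> v"
    using permutes_factor[OF bij2 bij3] by auto
  have "snd (\<sigma>2 w) = snd w" if "w \<in> ?V" for w
    using that \<sigma>2(2) bij1 unfolding bij_betw_def by (metis (no_types, lifting) imageE snd_conv)
  then have r2: "reach (grid_adj ml ms) ?V (450 * (3 * ml)) \<sigma>2"
    by (intro reach_snd_preserving ml ms \<sigma>2(1))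
  have "fst (\<sigma>3 w) = fst w" if "w \<in> ?V" for w
    using that \<sigma>3(2) bij2 unfolding bij_betw_def by (metis (no_types, lifting) imageE fst_conv)
  then have r3: "reach (grid_adj ml ms) ?V (450 * (3 * ms)) \<sigma>3"
    by (intro reach_fst_preserving ml ms \<sigma>3(1))
  have r1: "reach (grid_adj ml ms) ?V (450 * (3 * ms)) \<sigma>1"
    by (intro reach_fst_preserving ml ms \<sigma>1(1)) (simp add: \<sigma>1(2))
  have "\<pi> = \<sigma>3 \<circ> (\<sigma>2 \<circ> \<sigma>1)"
  proof
    fix v
    show "\<pi> v = (\<sigma>3 \<circ> (\<sigma>2 \<circ> \<sigma>1)) v"
      using \<sigma>1 \<sigma>2 \<sigma>3 \<pi> by (cases "v \<in> ?V") (simp_all add: permutes_not_in)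
  qed
  then show ?thesis
    using reach_mono[OF reach_comp[OF r3 reach_comp[OF r2 r1]], of "1350 * (ml + 2 * ms)"]
    by simp
qed

section \<open>From products of rotations to solutions of the path planning problem\<close>

text \<open>Post-composition with a rotation moves whichever robot occupies a vertex. The conjunct
  \<open>P n = p \<circ> X\<close> strengthens agreement on robots to equality of functions, so that
  the next step is appended by rewriting.\<close>

lemma reach_imp_mpp_solution:
  assumes "reach (grid_adj ml ms) (grid_vertices ml ms) n p" "is_config ml ms X"
  shows "\<exists>P. mpp_solution ml ms P n X (p \<circ> X) \<and> P n = p \<circ> X"
  using assms(1)
proof (induction rule: reach.induct)
  case reach_0
  show ?case
    by (intro exI[of _ "\<lambda>_. X"]) (simp add: mpp_solution_def)
next
  case (reach_Suc n p q)
  then obtain P where P: "mpp_solution ml ms P n X (p \<circ> X)" "P n = p \<circ> X"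
    by blast
  define P' where "P' t = (if t \<le> n then P t else q \<circ> p \<circ> X)" for t
  have X: "bij_betw X (robots ml ms) (grid_vertices ml ms)"
    using assms(2) by (simp add: is_config_def)
  have p: "bij_betw p (grid_vertices ml ms) (grid_vertices ml ms)"
    using reach_permutes[OF reach_Suc.hyps(1)] by (rule permutes_imp_bij)
  have q: "bij_betw q (grid_vertices ml ms) (grid_vertices ml ms)"
    using reach_Suc.hyps(2) by (simp add: rotation_def permutes_imp_bij)
  have pX: "bij_betw (p \<circ> X) (robots ml ms) (grid_vertices ml ms)"
    using X p by (rule bij_betw_trans)
  have qpX: "bij_betw (q \<circ> (p \<circ> X)) (robots ml ms) (grid_vertices ml ms)"
    using pX q by (rule bij_betw_trans)
  have "valid_step ml ms (p \<circ> X) (q \<circ> (p \<circ> X))"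
    unfolding valid_step_def is_config_def
  proof (intro conjI ballI impI notI pX qpX)
    fix r assume r: "r \<in> robots ml ms"
    then have "(p \<circ> X) r \<in> grid_vertices ml ms"
      using pX bij_betwE by blast
    then show "(q \<circ> (p \<circ> X)) r = (p \<circ> X) r \<or> grid_adj ml ms ((p \<circ> X) r) ((q \<circ> (p \<circ> X)) r)"
      using reach_Suc.hyps(2) by (simp add: rotation_def)
    fix r' assume r': "r' \<in> robots ml ms" "r \<noteq> r'"
      and "(q \<circ> (p \<circ> X)) r = (p \<circ> X) r' \<and> (q \<circ> (p \<circ> X)) r' = (p \<circ> X) r"
    \<comment> \<open>An exchange would be a 2-cycle of \<open>q\<close>; \<open>rotation\<close>
      turns it into a fixed point, so both robots would share a vertex.\<close>
    then have "(p \<circ> X) r = (p \<circ> X) r'"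
      using reach_Suc.hyps(2) unfolding rotation_def by (metis comp_apply)
    then show False
      using bij_betw_imp_inj_on[OF pX] r r' by (metis inj_onD)
  qed
  then have "mpp_solution ml ms P' (Suc n) X (q \<circ> p \<circ> X)"
    using P unfolding mpp_solution_def P'_def
    by (auto simp: less_Suc_eq Suc_le_eq o_assoc)
  moreover have "P' (Suc n) = q \<circ> p \<circ> X"
    by (simp add: P'_def)
  ultimately show ?case
    by blast
qed

theorem theorem1:
  "\<exists>C::nat. \<forall>ml ms XI XG.
     ml \<ge> ms \<longrightarrow> ml \<ge> 3 \<longrightarrow> ms \<ge> 2 \<longrightarrow>
     is_config ml ms XI \<longrightarrow> is_config ml ms XG \<longrightarrow>
     (\<exists>P T. mpp_solution ml ms P T XI XG \<and> T \<le> C * ml)"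
proof (intro exI[of _ 4050] allI impI)
  fix ml ms XI XG
  assume size: "ms \<le> ml" "3 \<le> ml" "2 \<le> ms" and XI: "is_config ml ms XI" and XG: "is_config ml ms XG"
  let ?V = "grid_vertices ml ms" and ?T = "1350 * (ml + 2 * ms)"
  have bij: "bij_betw XI (robots ml ms) ?V" "bij_betw XG (robots ml ms) ?V"
    using XI XG by (simp_all add: is_config_def)
  \<comment> \<open>The labels are eliminated here: only the vertex permutation from starts to goals
    has to be realised.\<close>
  have "bij_betw (XG \<circ> inv_into (robots ml ms) XI) ?V ?V"
    using bij bij_betw_inv_into bij_betw_trans by blast
  then obtain \<sigma> where \<sigma>: "\<sigma> permutes ?V" "\<And>v. v \<in> ?V \<Longrightarrow> \<sigma> v = XG (inv_into (robots ml ms) XI v)"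
    using permutes_factor[OF bij_betw_id] by (metis comp_apply id_apply)
  then obtain P where "mpp_solution ml ms P ?T XI (\<sigma> \<circ> XI)"
    using reach_imp_mpp_solution[OF reach_any_permutation[OF size(2,3) \<sigma>(1)] XI] by blast
  moreover have "(\<sigma> \<circ> XI) r = XG r" if "r \<in> robots ml ms" for r
    using that \<sigma>(2)[of "XI r"] bij(1) by (simp add: bij_betw_inv_into_left bij_betwE)
  ultimately have "mpp_solution ml ms P ?T XI XG"
    by (simp add: mpp_solution_def)
  moreover have "?T \<le> 4050 * ml"
    using size by simp
  ultimately show "\<exists>P T. mpp_solution ml ms P T XI XG \<and> T \<le> 4050 * ml"
    by blast
qed

end
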